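(* If $\mathcal I$ is a proper ideal on $\mathbb N$, then $\ell_{1,\mathcal I}=\ell_1$.
   Context: $\mathbb K$ is the scalar field. An ideal on $\mathbb N$ is a collection of subsets of $\mathbb N$ containing $\emptyset$, closed under subsets and finite unions; every ideal is assumed to contain all finite sets. It is proper if it is not $\mathcal P(\mathbb N)$. A scalar sequence $(s_n)$ is $\mathcal I$-convergent to $s$ if $\{n:|s_n-s|\ge\varepsilon\}\in\mathcal I$ for every $\varepsilon>0$. $\ell_{1,\mathcal I}$ is the set of all $(x_n)\in\mathbb K^{\mathbb N}$ such that the series $\sum_j|x_j|$ is $\mathcal I$-convergent, i.e. the sequence of partial sums $\big(\sum_{j=1}^n|x_j|\big)_n$ is $\mathcal I$-convergent to some real number. *)

theory Defs
  imports Complex_Main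
begin

definition is_ideal :: "nat set set \<Rightarrow> bool" where
  "is_ideal I \<longleftrightarrow>
     {} \<in> I \<and>
     (\<forall>A B. A \<in> I \<longrightarrow> B \<subseteq> A \<longrightarrow> B \<in> I) \<and>
     (\<forall>A B. A \<in> I \<longrightarrow> B \<in> I \<longrightarrow> A \<union> B \<in> I) \<and>
     (\<forall>A. finite A \<longrightarrow> A \<in> I)"

definition proper_ideal :: "nat set set \<Rightarrow> bool" where
  "proper_ideal I \<longleftrightarrow> is_ideal I \<and> I \<noteq> Pow UNIV"

text \<open>
  The scalar field is rendered by the class \<^class>\<open>real_normed_field\<close>: up to isomorphism its only
  instances are the real and the complex numbers, and its norm is the absolute value.
\<close>

definition ideal_convergent_to ::
    "nat set set \<Rightarrow> (nat \<Rightarrow> 'a::real_normed_field) \<Rightarrow> 'a \<Rightarrow> bool" where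
  "ideal_convergent_to I s l \<longleftrightarrow> (\<forall>\<epsilon>>0. {n. norm (s n - l) \<ge> \<epsilon>} \<in> I)"

text \<open>
  Sequences are indexed from 0, so the partial sum with index n runs over all j up to and including n.
\<close>

definition ell1_ideal :: "nat set set \<Rightarrow> (nat \<Rightarrow> 'a::real_normed_field) set" where
  "ell1_ideal I = {x. \<exists>l::real. ideal_convergent_to I (\<lambda>n. \<Sum>j\<le>n. norm (x j)) l}"

definition ell1 :: "(nat \<Rightarrow> 'a::real_normed_field) set" where
  "ell1 = {x. summable (\<lambda>j. norm (x j))}"

end

theory Submission
  imports Defs
begin

text \<open>The partial sums of the norms increase. A member of a proper ideal misses infinitely
  many indices, so an ideal limit l keeps partial sums below l + 1 at arbitrarily late indices,
  hence everywhere by monotonicity (\<open>incseq_ideal_convergent_to_bounded\<close>); a series of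
  nonnegative terms with bounded partial sums converges. Conversely, ordinary convergence has only
  finite exceptional sets, which every ideal contains
  (\<open>tendsto_imp_ideal_convergent_to\<close>).\<close>

text \<open>A finite complement would itself lie in \<open>I\<close>, hence so would its union with
  \<open>A\<close>, the whole of \<open>UNIV\<close>, and then every subset.\<close>

lemma infinite_Compl_proper_ideal:
  assumes "proper_ideal I" "A \<in> I"
  shows "infinite (- A)"
proof
  assume "finite (- A)"
  have I: "is_ideal I" "I \<noteq> UNIV"
    using assms(1) by (simp_all add: proper_ideal_def)
  have "- A \<in> I"
    using I(1) \<open>finite (- A)\<close> by (simp add: is_ideal_def)
  then have "A \<union> - A \<in> I"
    using I(1) assms(2) unfolding is_ideal_def by metis
  then have "B \<in> I" for B
    using I(1) unfolding is_ideal_def by (metis Compl_partition subset_UNIV)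
  with I(2) show False
    by blast
qed

lemma tendsto_imp_ideal_convergent_to:
  fixes s :: "nat \<Rightarrow> 'a::real_normed_field"
  assumes "is_ideal I" "s \<longlonglongrightarrow> l"
  shows "ideal_convergent_to I s l"
  unfolding ideal_convergent_to_def
proof (intro allI impI)
  fix \<epsilon> :: real
  assume "\<epsilon> > 0"
  \<comment> \<open>On the naturals, holding eventually means failing only finitely often.\<close>
  with assms(2) have "\<forall>\<^sub>F n in cofinite. \<not> norm (s n - l) \<ge> \<epsilon>"
    by (simp add: tendsto_iff dist_norm not_le cofinite_eq_sequentially)
  then have "finite {n. norm (s n - l) \<ge> \<epsilon>}"
    by (simp add: eventually_cofinite)
  with assms(1) show "{n. norm (s n - l) \<ge> \<epsilon>} \<in> I"
    by (simp add: is_ideal_def)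
qed

lemma incseq_ideal_convergent_to_bounded:
  fixes s :: "nat \<Rightarrow> real"
  assumes "proper_ideal I" "ideal_convergent_to I s l" "incseq s"
  shows "s n \<le> l + 1"
proof -
  \<comment> \<open>Only boundedness is wanted, so one tolerance suffices; the choice 1 gives the
    bound \<open>l + 1\<close>.\<close>
  have "{n. norm (s n - l) \<ge> 1} \<in> I"
    using assms(2) by (simp add: ideal_convergent_to_def)
  then have "infinite (- {n. norm (s n - l) \<ge> 1})"
    using assms(1) infinite_Compl_proper_ideal by blast
  \<comment> \<open>An infinite set of naturals is unbounded, so some index close to the limit lies
    beyond \<open>n\<close>.\<close>
  then obtain m where "m \<in> - {n. norm (s n - l) \<ge> 1}" "n < m"
    unfolding finite_nat_set_iff_bounded_le by (meson not_le)
  then have "n \<le> m" "norm (s m - l) < 1"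
    by simp_all
  moreover have "s n \<le> s m"
    using assms(3) \<open>n \<le> m\<close> by (rule incseqD)
  ultimately show ?thesis
    by (simp add: abs_less_iff)
qed

theorem proposition3p5:
  fixes I :: "nat set set"
  assumes "proper_ideal I"
  shows "(ell1_ideal I :: (nat \<Rightarrow> 'a::real_normed_field) set) = ell1"
proof (intro equalityI subsetI)
  fix x :: "nat \<Rightarrow> 'a"
  assume "x \<in> ell1_ideal I"
  then obtain l :: real where l: "ideal_convergent_to I (\<lambda>n. \<Sum>j\<le>n. norm (x j)) l"
    by (auto simp: ell1_ideal_def)
  have "incseq (\<lambda>n. \<Sum>j\<le>n. norm (x j))"
    by (simp add: incseq_SucI)
  with assms l have "(\<Sum>j\<le>n. norm (x j)) \<le> l + 1" for n
    by (rule incseq_ideal_convergent_to_bounded)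
  then have "summable (\<lambda>j. norm (x j))"
    by (intro bounded_imp_summable) simp_all
  then show "x \<in> ell1"
    by (simp add: ell1_def)
next
  fix x :: "nat \<Rightarrow> 'a"
  assume "x \<in> ell1"
  then have "(\<lambda>n. \<Sum>j\<le>n. norm (x j)) \<longlonglongrightarrow> (\<Sum>j. norm (x j))"
    by (simp add: ell1_def summable_LIMSEQ')
  \<comment> \<open>The ordinary sum serves as the ideal limit.\<close>
  then have "ideal_convergent_to I (\<lambda>n. \<Sum>j\<le>n. norm (x j)) (\<Sum>j. norm (x j))"
    using assms by (intro tendsto_imp_ideal_convergent_to) (simp_all add: proper_ideal_def)
  then show "x \<in> ell1_ideal I"
    by (auto simp: ell1_ideal_def)
qed

end
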